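(* For a pointed regular topological space $Y$ and a topological space $X$, the following conditions are equivalent: (1) the space $C_k'(X,Y)$ is analytic; (2) the space $C_k'(X,Y)$ is cosmic and the space $C_p'(X,Y)$ is analytic.
   Context: Regular spaces are understood to be $T_1$. A point $x\in X$ is isolated if $\{x\}$ is clopen in $X$; $X'$ is the set of non-isolated points of $X$. A pointed space is a topological space $Y$ with a distinguished point $*_Y$. $C_k(X,Y)$ (resp. $C_p(X,Y)$) is the space of continuous functions $X\to Y$ with the compact-open topology (resp. the topology of pointwise convergence, inherited from the product topology on $Y^X$). $C_k'(X,Y)=\{f\in C_k(X,Y):f(X')\subset\{*_Y\}\}$ and $C_p'(X,Y)=\{f\in C_p(X,Y):f(X')\subset\{*_Y\}\}$, with the subspace topologies. A topological space is analytic if it is the image of a Polish space under a continuous surjective map. A topological space $Z$ is cosmic if it is regular and has a countable network, i.e. a countable family $\mathcal N$ of subsets of $Z$ such that for any open $U\subset Z$ and $x\in U$ there is $N\in\mathcal N$ with $x\in N\subset U$. *)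

theory Defs
  imports "HOL-Analysis.Analysis"
begin

definition polish :: "'a topology \<Rightarrow> bool" where
  "polish P \<longleftrightarrow> separable_space P \<and> completely_metrizable_space P"

text \<open>HOL cannot quantify existentially over types, so the Polish spaces below are taken on
  subsets of the fixed type \<^typ>\<open>nat set\<close>, which has the cardinality of the continuum. This loses
  nothing, by the lemma \<open>analytic_if_polish_image\<close>.\<close>

definition analytic :: "'a topology \<Rightarrow> bool" where
  "analytic Z \<longleftrightarrow>
     (\<exists>(P :: nat set topology) g.
        polish P \<and> continuous_map P Z g \<and> g ` topspace P = topspace Z)"

definition network_of :: "'a topology \<Rightarrow> 'a set set \<Rightarrow> bool" where
  "network_of Z N \<longleftrightarrow>
     (\<forall>A\<in>N. A \<subseteq> topspace Z) \<and>
     (\<forall>U x. openin Z U \<and> x \<in> U \<longrightarrow> (\<exists>A\<in>N. x \<in> A \<and> A \<subseteq> U))"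

text \<open>Regularity includes $T_1$ throughout, whereas \<^const>\<open>regular_space\<close> does not.\<close>

definition cosmic :: "'a topology \<Rightarrow> bool" where
  "cosmic Z \<longleftrightarrow> regular_space Z \<and> t1_space Z \<and> (\<exists>N. countable N \<and> network_of Z N)"

text \<open>A point is isolated if its singleton is clopen, not merely open; the two notions differ when
  \<open>X\<close> is not $T_1$.\<close>

definition isolated_point :: "'a topology \<Rightarrow> 'a \<Rightarrow> bool" where
  "isolated_point X x \<longleftrightarrow> x \<in> topspace X \<and> openin X {x} \<and> closedin X {x}"

definition nonisolated :: "'a topology \<Rightarrow> 'a set" where
  "nonisolated X = {x \<in> topspace X. \<not> isolated_point X x}"

text \<open>Functions on the carrier of \<open>X\<close> are represented by extensional functions on the underlying
  type, as in \<^const>\<open>product_topology\<close>.\<close>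

definition cont_maps :: "'a topology \<Rightarrow> 'b topology \<Rightarrow> ('a \<Rightarrow> 'b) set" where
  "cont_maps X Y = {f \<in> extensional (topspace X). continuous_map X Y f}"

definition Ck :: "'a topology \<Rightarrow> 'b topology \<Rightarrow> ('a \<Rightarrow> 'b) topology" where
  "Ck X Y = topology_generated_by
     {{f \<in> cont_maps X Y. f ` K \<subseteq> U} | K U. compactin X K \<and> openin Y U}"

definition Cp :: "'a topology \<Rightarrow> 'b topology \<Rightarrow> ('a \<Rightarrow> 'b) topology" where
  "Cp X Y = subtopology (product_topology (\<lambda>_. Y) (topspace X)) (cont_maps X Y)"

definition Ck' :: "'a topology \<Rightarrow> 'b topology \<Rightarrow> 'b \<Rightarrow> ('a \<Rightarrow> 'b) topology" where
  "Ck' X Y y0 = subtopology (Ck X Y) {f. f ` nonisolated X \<subseteq> {y0}}"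

definition Cp' :: "'a topology \<Rightarrow> 'b topology \<Rightarrow> 'b \<Rightarrow> ('a \<Rightarrow> 'b) topology" where
  "Cp' X Y y0 = subtopology (Cp X Y) {f. f ` nonisolated X \<subseteq> {y0}}"

lemma topspace_Ck [simp]: "topspace (Ck X Y) = cont_maps X Y"
proof -
  have "cont_maps X Y \<in> {{f \<in> cont_maps X Y. f ` K \<subseteq> U} | K U. compactin X K \<and> openin Y U}"
    by (rule CollectI, rule exI[of _ "{}"], rule exI[of _ "{}"]) auto
  then show ?thesis
    unfolding Ck_def topology_generated_by_topspace by blast
qed

lemma topspace_Cp [simp]: "topspace (Cp X Y) = cont_maps X Y"
  by (auto simp: Cp_def cont_maps_def PiE_def continuous_map_def)

lemma polish_inj_nat_set:
  assumes "polish Q"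
  obtains h :: "'a \<Rightarrow> nat set" where "inj_on h (topspace Q)"
proof -
  obtain M d where "Metric_space M d" and Q: "Q = Metric_space.mtopology M d"
    using assms unfolding polish_def completely_metrizable_space_def by blast
  then interpret Metric_space M d by simp
  obtain C where C: "countable C" "C \<subseteq> M" "mtopology closure_of C = M"
    using assms unfolding polish_def separable_space_def Q by auto
  define h where "h x = {n. case prod_decode n of (i, k) \<Rightarrow>
    d x (from_nat_into C i) < inverse (Suc k)}" for x
  have "x = y" if "x \<in> M" "y \<in> M" "h x = h y" for x y
  proof (rule ccontr)
    assume "x \<noteq> y"
    then have "0 < d x y / 2" using that by simp
    then obtain k where k: "inverse (real (Suc k)) < d x y / 2"
      using reals_Archimedean by blast
    have "x \<in> mtopology closure_of C" using C that by simp
    then have "\<forall>r>0. \<exists>c\<in>C. c \<in> mball x r"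
      unfolding metric_closure_of by blast
    moreover have "0 < inverse (real (Suc k))" by simp
    ultimately obtain c where c: "c \<in> C" "c \<in> mball x (inverse (real (Suc k)))"
      by blast
    obtain i where i: "from_nat_into C i = c"
      using from_nat_into_surj[OF C(1) c(1)] by blast
    have "prod_encode (i, k) \<in> h x" using c by (simp add: h_def i)
    then have "prod_encode (i, k) \<in> h y" using that(3) by simp
    then have "d y c < inverse (Suc k)" by (simp add: h_def i)
    moreover have "d x c < inverse (Suc k)" using c by simp
    moreover have "d x y \<le> d x c + d y c"
      using triangle'[of x c y] that c C by (auto simp: commute)
    ultimately show False using k by linarith
  qed
  then show thesis using that[of h] by (auto simp: inj_on_def Q)
qed

lemma analytic_if_polish_image:
  assumes "polish Q" "continuous_map Q Z f" "f ` topspace Q = topspace Z"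
  shows "analytic Z"
proof -
  obtain h :: "'a \<Rightarrow> nat set" where h: "inj_on h (topspace Q)"
    using polish_inj_nat_set[OF assms(1)] .
  let ?k = "inv_into (topspace Q) h"
  define P where "P = pullback_topology (h ` topspace Q) ?k Q"
  have tP: "topspace P = h ` topspace Q"
    using h by (auto simp: P_def topspace_pullback_topology inv_into_into)
  have k: "continuous_map P Q ?k"
    using continuous_map_pullback[of Q Q id] unfolding P_def by simp
  have "continuous_map Q Q (?k \<circ> h)"
    by (rule continuous_map_eq[OF continuous_map_id]) (use h in auto)
  then have "continuous_map Q P h"
    unfolding P_def by (intro continuous_map_pullback') auto
  then have "homeomorphic_maps P Q ?k h"
    using k h tP by (auto simp: homeomorphic_maps_def f_inv_into_f)
  then have "P homeomorphic_space Q" by (auto simp: homeomorphic_space_def)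
  then have "polish P"
    using assms(1) homeomorphic_separable_space homeomorphic_completely_metrizable_space
    unfolding polish_def by blast
  moreover have "continuous_map P Z (f \<circ> ?k)"
    using k assms(2) by (rule continuous_map_compose)
  moreover have "(f \<circ> ?k) ` topspace P = topspace Z"
    using h by (simp add: tP image_image assms(3))
  ultimately show ?thesis unfolding analytic_def by blast
qed

end

theory Submission
  imports Defs
begin

text \<open>Since \<open>Y\<close> is regular, every point of \<open>Ck'\<close> has a base of neighbourhoods that are closed in the
  coarser topology of \<open>Cp'\<close>, so a countable network of \<open>Ck'\<close> can be chosen to consist of \<open>Cp'\<close>-closed
  sets. Given a continuous surjection from a Polish space onto \<open>Cp'\<close>, refine the Polish topology so
  that the countably many closed preimages of network members become open; the refinement is still
  Polish, and the same map is now continuous into \<open>Ck'\<close>.\<close>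

section \<open>Countable networks: subspaces, products, images and separability\<close>

lemma network_ofE:
  assumes "network_of Z N" "openin Z U" "x \<in> U"
  obtains A where "A \<in> N" "x \<in> A" "A \<subseteq> U"
  using assms unfolding network_of_def by blast

lemma network_of_subtopology:
  assumes "network_of Z N"
  shows "network_of (subtopology Z S) ((\<lambda>A. A \<inter> S) ` N)"
proof -
  have "\<exists>A\<in>N. x \<in> A \<inter> S \<and> A \<inter> S \<subseteq> U"
    if U: "openin (subtopology Z S) U" "x \<in> U" for U x
  proof -
    obtain V where V: "openin Z V" "U = V \<inter> S"
      using U(1) by (auto simp: openin_subtopology)
    then obtain A where "A \<in> N" "x \<in> A" "A \<subseteq> V"
      using network_ofE[OF assms] U(2) by (metis IntD1)
    then show ?thesis using V U(2) by blast
  qed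
  then show ?thesis
    using assms unfolding network_of_def by auto
qed

text \<open>Every open set contains an open box around each of its points, and each side of the box
  can be shrunk to a network member.\<close>

lemma network_of_prod_topology:
  assumes "network_of Z N" "network_of W M"
  shows "network_of (prod_topology Z W) ((\<lambda>(A, B). A \<times> B) ` (N \<times> M))"
proof -
  have "\<exists>A\<in>N. \<exists>B\<in>M. (x, y) \<in> A \<times> B \<and> A \<times> B \<subseteq> U"
    if U: "openin (prod_topology Z W) U" "(x, y) \<in> U" for U x y
  proof -
    obtain V V' where V: "openin Z V" "openin W V'" "x \<in> V" "y \<in> V'" "V \<times> V' \<subseteq> U"
      using U(1)[unfolded openin_prod_topology_alt, rule_format, OF U(2)] by auto
    obtain A where A: "A \<in> N" "x \<in> A" "A \<subseteq> V"
      using network_ofE[OF assms(1) V(1,3)] .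
    obtain B where B: "B \<in> M" "y \<in> B" "B \<subseteq> V'"
      using network_ofE[OF assms(2) V(2,4)] .
    have "A \<times> B \<subseteq> U"
      using Sigma_mono[OF A(3) B(3)] V(5) by (rule subset_trans)
    with A(1,2) B(1,2) show ?thesis by (intro bexI conjI SigmaI)
  qed
  moreover have "A \<times> B \<subseteq> topspace (prod_topology Z W)" if "A \<in> N" "B \<in> M" for A B
    using that assms unfolding network_of_def by (auto simp: subset_iff)
  ultimately show ?thesis
    unfolding network_of_def by (simp add: split_paired_all)
qed

lemma network_of_continuous_map_image:
  assumes "network_of Z N" "continuous_map Z W f" "f ` topspace Z = topspace W"
  shows "network_of W ((`) f ` N)"
proof -
  have "\<exists>A\<in>N. y \<in> f ` A \<and> f ` A \<subseteq> U" if U: "openin W U" "y \<in> U" for U y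
  proof -
    obtain x where x: "x \<in> topspace Z" "y = f x"
      using openin_subset[OF U(1)] U(2) assms(3) by blast
    have "openin Z {x \<in> topspace Z. f x \<in> U}"
      using openin_continuous_map_preimage[OF assms(2) U(1)] .
    then obtain A where "A \<in> N" "x \<in> A" "A \<subseteq> {x \<in> topspace Z. f x \<in> U}"
      using network_ofE[OF assms(1)] x U(2) by (metis (mono_tags, lifting) mem_Collect_eq)
    then show ?thesis using x by blast
  qed
  then show ?thesis
    using assms(1,3) unfolding network_of_def by fastforce
qed

text \<open>One point chosen from each nonempty member gives a dense set. Separability alone does
  not pass to subspaces, whereas a countable network does, so networks carry the countability
  through the constructions below.\<close>

lemma countable_network_imp_separable_space:
  assumes "countable N" "network_of Z N"
  shows "separable_space Z"
proof -
  define C where "C = (\<lambda>A. SOME x. x \<in> A) ` (N - {{}})"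
  have some: "(SOME x. x \<in> A) \<in> A" if "A \<in> N - {{}}" for A
    using that some_in_eq by blast
  have "C \<subseteq> topspace Z"
    using some assms(2) unfolding C_def network_of_def by blast
  moreover have "Z closure_of C = topspace Z"
  proof (intro equalityI closure_of_subset_topspace subsetI)
    fix x assume x: "x \<in> topspace Z"
    have "\<exists>y\<in>C. y \<in> U" if "x \<in> U" "openin Z U" for U
    proof -
      obtain A where "A \<in> N" "x \<in> A" "A \<subseteq> U"
        using network_ofE[OF assms(2)] \<open>openin Z U\<close> \<open>x \<in> U\<close> by blast
      then show ?thesis using some unfolding C_def by blast
    qed
    with x show "x \<in> Z closure_of C"
      unfolding in_closure_of by blast
  qed
  moreover have "countable C"
    using assms(1) by (simp add: C_def)
  ultimately show ?thesis
    unfolding separable_space_def by blast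
qed

section \<open>Polish spaces: products, \<open>G\<^sub>\<delta>\<close> subspaces and refinements of
  the topology\<close>

lemma polish_imp_countable_network:
  assumes "polish P"
  obtains N where "countable N" "network_of P N"
proof -
  obtain M d where "Metric_space M d" and P: "P = Metric_space.mtopology M d"
    using assms unfolding polish_def completely_metrizable_space_def by blast
  then interpret Metric_space M d by simp
  obtain C where C: "countable C" "C \<subseteq> M" "mtopology closure_of C = M"
    using assms unfolding polish_def separable_space_def P by auto
  \<comment> \<open>Balls of radius \<open>1/(n+1)\<close> around the points of a countable dense
    set.\<close>
  define N where "N = (\<lambda>(c, n). mball c (inverse (real (Suc n)))) ` (C \<times> UNIV)"
  have "\<exists>A\<in>N. x \<in> A \<and> A \<subseteq> U" if U: "openin mtopology U" "x \<in> U" for U x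
  proof -
    obtain r where r: "r > 0" "mball x r \<subseteq> U" and x: "x \<in> M"
      using U unfolding openin_mtopology by blast
    \<comment> \<open>Half of \<open>r\<close> suffices: a ball of this radius that contains
      \<open>x\<close> has all its points within twice the radius of \<open>x\<close>.\<close>
    obtain n where n: "inverse (real (Suc n)) < r / 2"
      using reals_Archimedean[of "r / 2"] r(1) by auto
    have "x \<in> mtopology closure_of C" using C x by simp
    moreover have "0 < inverse (real (Suc n))" by simp
    ultimately obtain c where c: "c \<in> C" "c \<in> mball x (inverse (real (Suc n)))"
      unfolding metric_closure_of by blast
    then have cx: "d c x < inverse (real (Suc n))" "c \<in> M" by (auto simp: commute)
    have "d x z < r" if "z \<in> M" "d c z < inverse (real (Suc n))" for z
      using triangle[of x c z] that cx x n by (simp add: commute)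
    then have "mball c (inverse (real (Suc n))) \<subseteq> U"
      using r(2) x by auto
    moreover have "x \<in> mball c (inverse (real (Suc n)))"
      using cx x by simp
    moreover have "mball c (inverse (real (Suc n))) \<in> N"
      using c(1) unfolding N_def by blast
    ultimately show ?thesis by blast
  qed
  then have "network_of P N"
    unfolding network_of_def P N_def by auto
  moreover have "countable N"
    using C(1) unfolding N_def by simp
  ultimately show thesis using that by blast
qed

lemma polish_prod_topology:
  assumes "polish P" "polish Q"
  shows "polish (prod_topology P Q)"
proof -
  obtain N M where "countable N" "network_of P N" "countable M" "network_of Q M"
    using polish_imp_countable_network assms by metis
  then have "separable_space (prod_topology P Q)"
    by (intro countable_network_imp_separable_space[OF _ network_of_prod_topology]) auto
  then show ?thesis
    using assms by (simp add: polish_def completely_metrizable_space_prod_topology)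
qed

text \<open>Complete metrizability passes to \<open>G\<^sub>\<delta>\<close> subsets; separability
  is recovered from the traces of a countable network.\<close>

lemma polish_subtopology_gdelta_in:
  assumes "polish P" "gdelta_in P S"
  shows "polish (subtopology P S)"
proof -
  obtain N where "countable N" "network_of P N"
    using polish_imp_countable_network assms(1) by blast
  then have "separable_space (subtopology P S)"
    by (intro countable_network_imp_separable_space[OF _ network_of_subtopology]) auto
  then show ?thesis
    using assms by (simp add: polish_def completely_metrizable_space_gdelta_in)
qed

lemma polish_euclidean: "polish (euclidean :: 'a::polish_space topology)"
proof -
  obtain B :: "'a set set" where B: "countable B" "topological_basis B"
    using ex_countable_basis by blast
  have "network_of euclidean B"
    using topological_basisE[OF B(2)] unfolding network_of_def by (metis open_openin subset_UNIV topspace_euclidean)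
  then show ?thesis
    using countable_network_imp_separable_space B(1) completely_metrizable_space_euclidean
    unfolding polish_def by blast
qed

text \<open>The refinement is the graph, inside \<open>P \<times> \<real>\<^sup>\<nat>\<close>, of the sequence of indicator functions of the
  sets \<open>F n\<close>; an indicator of a closed set has a \<open>G\<^sub>\<delta>\<close> graph.\<close>

lemma polish_refinement_open:
  fixes P :: "'a topology"
  assumes P: "polish P" and F: "\<And>n::nat. closedin P (F n)"
  obtains Q :: "('a \<times> (nat \<Rightarrow> real)) topology" where
    "polish Q" "continuous_map Q P fst" "fst ` topspace Q = topspace P"
    "\<And>n. openin Q {q \<in> topspace Q. fst q \<in> F n}"
proof -
  let ?R = "prod_topology P (euclidean :: (nat \<Rightarrow> real) topology)"
  define G where "G n = {q \<in> topspace ?R. snd q n = indicator (F n) (fst q)}" for n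
  define Q where "Q = subtopology ?R (\<Inter>n. G n)"
  have R: "polish ?R"
    using P polish_euclidean by (rule polish_prod_topology)
  then have metrizable: "metrizable_space ?R"
    unfolding polish_def using completely_metrizable_imp_metrizable_space by blast
  have coord: "continuous_map ?R euclidean (\<lambda>q. snd q n)" for n
  proof -
    have "continuous_map (euclidean :: (nat \<Rightarrow> real) topology) euclidean (\<lambda>s. s n)"
      by (simp add: continuous_on_product_coordinates)
    from continuous_map_compose[OF continuous_map_snd this] show ?thesis
      by (simp add: o_def)
  qed
  have value_closed: "gdelta_in ?R {q \<in> topspace ?R. snd q n \<in> {c}}" for n and c :: real
    by (intro closed_imp_gdelta_in[OF metrizable] closedin_continuous_map_preimage[OF coord]) simp
  have "gdelta_in ?R (G n)" for n
  proof -
    have "gdelta_in ?R {q \<in> topspace ?R. fst q \<in> F n}"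
      by (intro closed_imp_gdelta_in[OF metrizable]
            closedin_continuous_map_preimage[OF continuous_map_fst F])
    moreover have "gdelta_in ?R {q \<in> topspace ?R. fst q \<in> topspace P - F n}"
      using F by (intro open_imp_gdelta_in openin_continuous_map_preimage[OF continuous_map_fst]) blast
    \<comment> \<open>Over \<open>F n\<close> the graph is the level set of the value 1, over the
      complement that of the value 0. The pieces are closed or open, hence
      \<open>G\<^sub>\<delta>\<close> by metrizability.\<close>
    moreover have "G n =
        {q \<in> topspace ?R. fst q \<in> F n} \<inter> {q \<in> topspace ?R. snd q n \<in> {1}} \<union>
        {q \<in> topspace ?R. fst q \<in> topspace P - F n} \<inter> {q \<in> topspace ?R. snd q n \<in> {0}}"
      by (auto simp: G_def indicator_def)
    ultimately show ?thesis
      using value_closed by (simp only: gdelta_in_Un gdelta_in_Int)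
  qed
  then have "gdelta_in ?R (\<Inter>n. G n)"
    by (intro gdelta_in_Inter) auto
  with R have "polish Q"
    unfolding Q_def by (rule polish_subtopology_gdelta_in)
  moreover have "continuous_map Q P fst"
    unfolding Q_def by (intro continuous_map_from_subtopology continuous_map_fst)
  moreover have "fst ` topspace Q = topspace P"
  proof -
    \<comment> \<open>The point of \<open>Q\<close> above \<open>p\<close> records for each
      \<open>n\<close> whether \<open>p\<close> lies in \<open>F n\<close>.\<close>
    have "p \<in> fst ` topspace Q" if "p \<in> topspace P" for p
      using that by (intro image_eqI[where x = "(p, \<lambda>n. indicator (F n) p)"])
        (auto simp: Q_def G_def)
    then show ?thesis by (auto simp: Q_def)
  qed
  moreover have "openin Q {q \<in> topspace Q. fst q \<in> F n}" for n
  proof -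
    have eq: "snd q n = indicator (F n) (fst q)" if "q \<in> topspace Q" for q
      using that by (simp add: Q_def G_def)
    \<comment> \<open>On \<open>Q\<close> the \<open>n\<close>-th coordinate takes only the values 0
      and 1, so the threshold \<open>1/2\<close> isolates the value 1 by an open condition.\<close>
    have "openin Q {q \<in> topspace Q. snd q n \<in> {1/2<..}}"
      unfolding Q_def
      by (intro openin_continuous_map_preimage[OF continuous_map_from_subtopology[OF coord]]) simp
    also have "{q \<in> topspace Q. snd q n \<in> {1/2<..}} = {q \<in> topspace Q. fst q \<in> F n}"
      by (intro Collect_cong conj_cong refl) (simp add: eq indicator_def)
    finally show ?thesis .
  qed
  ultimately show thesis by (rule that)
qed

section \<open>Analytic spaces, their images and finer topologies\<close>

lemma analytic_imp_countable_network:
  assumes "analytic Z"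
  obtains N where "countable N" "network_of Z N"
proof -
  obtain P :: "nat set topology" and g where
    P: "polish P" and g: "continuous_map P Z g" "g ` topspace P = topspace Z"
    using assms unfolding analytic_def by blast
  obtain N where "countable N" "network_of P N"
    using polish_imp_countable_network[OF P] .
  then show thesis
    using that network_of_continuous_map_image[OF _ g] by blast
qed

lemma analytic_continuous_map_image:
  assumes "analytic Z" "continuous_map Z W f" "f ` topspace Z = topspace W"
  shows "analytic W"
proof -
  obtain P :: "nat set topology" and g where
    P: "polish P" and g: "continuous_map P Z g" "g ` topspace P = topspace Z"
    using assms(1) unfolding analytic_def by blast
  have "(f \<circ> g) ` topspace P = topspace W"
    using g(2) assms(3) by (metis image_comp)
  with P continuous_map_compose[OF g(1) assms(2)] show ?thesis
    unfolding analytic_def by blast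
qed

text \<open>If \<open>A \<subseteq> V \<subseteq> C \<subseteq> U\<close> with \<open>C\<close>
  closed in \<open>W\<close>, then the \<open>W\<close>-closure of \<open>A\<close> still lies in
  \<open>C\<close>, hence in \<open>U\<close>.\<close>

lemma network_of_closedin_sets:
  assumes "network_of Z N" and top: "topspace Z = topspace W"
    and base: "neighbourhood_base_of (closedin W) Z"
  shows "network_of Z ((closure_of) W ` N)"
proof -
  have "\<exists>A\<in>N. x \<in> W closure_of A \<and> W closure_of A \<subseteq> U"
    if U: "openin Z U" "x \<in> U" for U x
  proof -
    obtain V C where V: "openin Z V" "closedin W C" "x \<in> V" "V \<subseteq> C" "C \<subseteq> U"
      using base U unfolding neighbourhood_base_of by meson
    obtain A where A: "A \<in> N" "x \<in> A" "A \<subseteq> V"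
      using network_ofE[OF assms(1) V(1,3)] .
    have "A \<subseteq> W closure_of A"
      using A(1) assms(1) top unfolding network_of_def by (intro closure_of_subset) auto
    moreover have "W closure_of A \<subseteq> C"
      using A(3) V(2,4) by (intro closure_of_minimal) auto
    ultimately show ?thesis
      using A V(5) by blast
  qed
  then show ?thesis
    using top unfolding network_of_def by (auto dest: in_closure_of[THEN iffD1])
qed

text \<open>Every \<open>Z\<close>-open set is a union of sets from one countable family of
  \<open>W\<close>-closed sets. It is enough to make their preimages open in a finer Polish
  topology.\<close>

lemma analytic_finer_topology:
  assumes W: "analytic W" and top: "topspace Z = topspace W"
    and base: "neighbourhood_base_of (closedin W) Z"
    and N: "countable N" "network_of Z N"
  shows "analytic Z"
proof -
  obtain P :: "nat set topology" and g where
    P: "polish P" and g: "continuous_map P W g" "g ` topspace P = topspace W"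
    using W unfolding analytic_def by blast
  \<comment> \<open>Adjoining \<open>{}\<close>, which is closed, makes the family nonempty, so that
    \<open>from_nat_into\<close> enumerates exactly this family.\<close>
  define C where "C = from_nat_into (insert {} ((closure_of) W ` N))"
  have range_C: "range C = insert {} ((closure_of) W ` N)"
    unfolding C_def using N(1) by (intro range_from_nat_into) auto
  have C_closed: "closedin W (C n)" for n
    using rangeI[of C n] unfolding range_C by auto
  have net: "network_of Z ((closure_of) W ` N)"
    using N(2) top base by (rule network_of_closedin_sets)
  have "closedin P {p \<in> topspace P. g p \<in> C n}" for n
    using g(1) C_closed by (rule closedin_continuous_map_preimage)
  from polish_refinement_open[where F = "\<lambda>n. {p \<in> topspace P. g p \<in> C n}", OF P this]
  obtain Q :: "(nat set \<times> (nat \<Rightarrow> real)) topology" where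
    Q: "polish Q" "continuous_map Q P fst" "fst ` topspace Q = topspace P"
    "\<And>n. openin Q {q \<in> topspace Q. fst q \<in> {p \<in> topspace P. g p \<in> C n}}" by blast
  have surj: "(g \<circ> fst) ` topspace Q = topspace Z"
    using Q(3) g(2) top by (metis image_comp)
  have "continuous_map Q Z (g \<circ> fst)"
    unfolding continuous_map_def
  proof (intro conjI allI impI)
    show "g \<circ> fst \<in> topspace Q \<rightarrow> topspace Z"
      using surj by blast
  next
    fix U assume U: "openin Z U"
    \<comment> \<open>The network property writes the preimage of \<open>U\<close> as a union of
      preimages that the refinement has made open.\<close>
    have "{q \<in> topspace Q. (g \<circ> fst) q \<in> U} =
        \<Union> ((\<lambda>n. {q \<in> topspace Q. fst q \<in> {p \<in> topspace P. g p \<in> C n}}) ` {n. C n \<subseteq> U})"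
      (is "?L = ?R")
    proof
      show "?L \<subseteq> ?R"
      proof
        fix q assume q: "q \<in> ?L"
        then obtain A where A: "A \<in> (closure_of) W ` N" "g (fst q) \<in> A" "A \<subseteq> U"
          using network_ofE[OF net U] by auto
        then obtain n where "C n = A"
          using range_C by (metis insertI2 rangeE)
        with q A Q(3) show "q \<in> ?R" by blast
      qed
    qed auto
    also have "openin Q \<dots>"
      using Q(4) by (intro openin_Union) auto
    finally show "openin Q {q \<in> topspace Q. (g \<circ> fst) q \<in> U}" .
  qed
  \<comment> \<open>\<open>Q\<close> does not live on \<open>nat set\<close>, so it is first
    transported there by \<open>analytic_if_polish_image\<close>.\<close>
  with surj show ?thesis
    using Q(1) analytic_if_polish_image by blast
qed

section \<open>Function spaces: compact-open versus pointwise topology\<close>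

lemma openin_Ck:
  assumes "compactin X K" "openin Y U"
  shows "openin (Ck X Y) {f \<in> cont_maps X Y. f ` K \<subseteq> U}"
  unfolding Ck_def using assms by (intro topology_generated_by_Basis) blast

lemma continuous_map_Cp_eval:
  assumes "x \<in> topspace X"
  shows "continuous_map (Cp X Y) Y (\<lambda>f. f x)"
  unfolding Cp_def using assms
  by (intro continuous_map_from_subtopology continuous_map_product_projection)

text \<open>The condition is imposed pointwise, so it is an intersection of closed preimages under
  evaluations; \<open>K\<close> may be infinite, since closed sets admit arbitrary
  intersections.\<close>

lemma closedin_Cp:
  assumes "K \<subseteq> topspace X" "closedin Y C"
  shows "closedin (Cp X Y) {f \<in> cont_maps X Y. f ` K \<subseteq> C}"
proof -
  have "closedin (Cp X Y) {f \<in> topspace (Cp X Y). f x \<in> C}" if "x \<in> K" for x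
    using that assms by (intro closedin_continuous_map_preimage[OF continuous_map_Cp_eval]) auto
  \<comment> \<open>The factor \<open>topspace (Cp X Y)\<close> covers \<open>K = {}\<close>, where
    the intersection over \<open>K\<close> is the whole type.\<close>
  then have "closedin (Cp X Y)
      (topspace (Cp X Y) \<inter> (\<Inter>x\<in>K. {f \<in> topspace (Cp X Y). f x \<in> C}))"
    by (cases "K = {}") (auto simp del: topspace_Cp)
  also have "topspace (Cp X Y) \<inter> (\<Inter>x\<in>K. {f \<in> topspace (Cp X Y). f x \<in> C}) =
      {f \<in> cont_maps X Y. f ` K \<subseteq> C}"
    by auto
  finally show ?thesis .
qed

text \<open>Singletons are compact, so every evaluation is continuous for the compact-open
  topology.\<close>

lemma continuous_map_Ck_Cp: "continuous_map (Ck X Y) (Cp X Y) id"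
proof -
  have "continuous_map (Ck X Y) Y (\<lambda>f. f x)" if x: "x \<in> topspace X" for x
    unfolding continuous_map_def
  proof (intro conjI allI impI)
    show "(\<lambda>f. f x) \<in> topspace (Ck X Y) \<rightarrow> topspace Y"
      using x by (auto simp: cont_maps_def continuous_map_def)
  next
    fix U assume "openin Y U"
    then show "openin (Ck X Y) {f \<in> topspace (Ck X Y). f x \<in> U}"
      using openin_Ck[of X "{x}" Y U] x by simp
  qed
  then show ?thesis
    unfolding Cp_def continuous_map_in_subtopology
    by (auto simp: continuous_map_componentwise cont_maps_def)
qed

text \<open>Induction on the generation of open sets. For a subbasic set, \<open>f\<close>
  K\<open>is compact inside\<close>U\<open>, and regularity of\<close>Y\<open>fits a closed set between a neighbourhood of\<close>f
  \<open>K\<close> and \<open>U\<close>.\<close>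

lemma neighbourhood_base_of_closedin_Cp_Ck:
  assumes "regular_space Y"
  shows "neighbourhood_base_of (closedin (Cp X Y)) (Ck X Y)"
proof -
  have "\<exists>U V. openin (Ck X Y) U \<and> closedin (Cp X Y) V \<and> f \<in> U \<and> U \<subseteq> V \<and> V \<subseteq> G"
    if "generate_topology_on
      {{f \<in> cont_maps X Y. f ` K \<subseteq> U} | K U. compactin X K \<and> openin Y U} G" "f \<in> G" for G f
    using that
  proof (induction G)
    case Empty
    then show ?case by simp
  next
    case (Int a b)
    then obtain U V U' V' where
      "openin (Ck X Y) U" "closedin (Cp X Y) V" "f \<in> U" "U \<subseteq> V" "V \<subseteq> a"
      "openin (Ck X Y) U'" "closedin (Cp X Y) V'" "f \<in> U'" "U' \<subseteq> V'" "V' \<subseteq> b"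
      by blast
    then show ?case
      by (intro exI[of _ "U \<inter> U'"] exI[of _ "V \<inter> V'"]) auto
  next
    case (UN K)
    \<comment> \<open>The neighbourhoods found inside the member containing \<open>f\<close> serve
      for the union.\<close>
    then show ?case by (meson Sup_upper UnionE subset_trans)
  next
    case (Basis G)
    then obtain K U where KU: "compactin X K" "openin Y U"
      and G: "G = {f \<in> cont_maps X Y. f ` K \<subseteq> U}"
      by blast
    with Basis have f: "f \<in> cont_maps X Y" "f ` K \<subseteq> U" by auto
    then have "compactin Y (f ` K)"
      using KU(1) image_compactin unfolding cont_maps_def by blast
    moreover have "closedin Y (topspace Y - U)" "disjnt (f ` K) (topspace Y - U)"
      using KU(2) f(2) by (auto simp: disjnt_def)
    ultimately obtain V V' where V: "openin Y V" "openin Y V'" "f ` K \<subseteq> V"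
      "topspace Y - U \<subseteq> V'" "disjnt V V'"
      using regular_space_compact_closed_separation[OF assms] by metis
    \<comment> \<open>\<open>topspace Y - V'\<close> is the closed set between \<open>V\<close> and
      \<open>U\<close>; it defines the \<open>Cp\<close>-closed neighbourhood.\<close>
    have VU: "V \<subseteq> topspace Y - V'" "topspace Y - V' \<subseteq> U"
      using V(4,5) openin_subset[OF V(1)] by (auto simp: disjnt_def)
    have "openin (Ck X Y) {f \<in> cont_maps X Y. f ` K \<subseteq> V}"
      using KU(1) V(1) by (rule openin_Ck)
    moreover have "closedin (Cp X Y) {f \<in> cont_maps X Y. f ` K \<subseteq> topspace Y - V'}"
      using KU(1) V(2) by (intro closedin_Cp) (auto dest: compactin_subset_topspace)
    moreover have "f \<in> {f \<in> cont_maps X Y. f ` K \<subseteq> V}"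
      using f(1) V(3) by simp
    moreover have "{f \<in> cont_maps X Y. f ` K \<subseteq> V} \<subseteq> {f \<in> cont_maps X Y. f ` K \<subseteq> topspace Y - V'}"
      using VU(1) by blast
    moreover have "{f \<in> cont_maps X Y. f ` K \<subseteq> topspace Y - V'} \<subseteq> G"
      using VU(2) unfolding G by blast
    ultimately show ?case by blast
  qed
  then show ?thesis
    unfolding neighbourhood_base_of Ck_def openin_topology_generated_by_iff by blast
qed

lemma neighbourhood_base_of_closedin_subtopology:
  assumes "neighbourhood_base_of (closedin W) Z"
  shows "neighbourhood_base_of (closedin (subtopology W S)) (subtopology Z S)"
  unfolding neighbourhood_base_of
proof (intro allI impI, elim conjE)
  fix U x assume "openin (subtopology Z S) U" "x \<in> U"
  then obtain U' where U': "openin Z U'" "U = U' \<inter> S" "x \<in> U'" "x \<in> S"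
    by (auto simp: openin_subtopology)
  then obtain V C where "openin Z V" "closedin W C" "x \<in> V" "V \<subseteq> C" "C \<subseteq> U'"
    using assms unfolding neighbourhood_base_of by meson
  then show "\<exists>V C. openin (subtopology Z S) V \<and> closedin (subtopology W S) C \<and>
      x \<in> V \<and> V \<subseteq> C \<and> C \<subseteq> U"
    using U' by (intro exI[of _ "V \<inter> S"] exI[of _ "C \<inter> S"])
      (auto simp: openin_subtopology closedin_subtopology)
qed

theorem proposition11p2:
  fixes X :: "'a topology" and Y :: "'b topology" and y0 :: 'b
  assumes "regular_space Y" and "t1_space Y" and "y0 \<in> topspace Y"
  shows "analytic (Ck' X Y y0) \<longleftrightarrow> cosmic (Ck' X Y y0) \<and> analytic (Cp' X Y y0)"
proof -
  have top: "topspace (Ck' X Y y0) = topspace (Cp' X Y y0)"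
    by (simp add: Ck'_def Cp'_def)
  have id: "continuous_map (Ck' X Y y0) (Cp' X Y y0) id"
    unfolding Ck'_def Cp'_def continuous_map_in_subtopology
    by (auto intro: continuous_map_from_subtopology continuous_map_Ck_Cp[unfolded id_def] simp: id_def)
  \<comment> \<open>Both spaces are cut out by the same set of functions, so the neighbourhood base
    restricts.\<close>
  have base: "neighbourhood_base_of (closedin (Cp' X Y y0)) (Ck' X Y y0)"
    unfolding Ck'_def Cp'_def
    using neighbourhood_base_of_closedin_Cp_Ck[OF assms(1)]
    by (rule neighbourhood_base_of_closedin_subtopology)
  have open_Ck': "openin (Ck' X Y y0) U" if "openin (Cp' X Y y0) U" for U
    using openin_continuous_map_preimage[OF id that] openin_subset[OF that] top
    by (simp add: Int_absorb1 Collect_conj_eq)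
  then have "closedin (Ck' X Y y0) C" if "closedin (Cp' X Y y0) C" for C
    using that top unfolding closedin_def by simp
  \<comment> \<open>Sets closed in the coarser \<open>Cp'\<close> are closed in \<open>Ck'\<close>,
    so \<open>base\<close> becomes a base of closed neighbourhoods, which is regularity.\<close>
  then have regular: "regular_space (Ck' X Y y0)"
    using neighbourhood_base_of_mono[OF base] neighbourhood_base_of_closedin by blast
  have "t1_space (Cp' X Y y0)"
    unfolding Cp'_def Cp_def using assms(2)
    by (intro t1_space_subtopology) (simp add: t1_space_product_topology)
  \<comment> \<open>\<open>T1\<close> survives passing to a finer topology on the same
    points.\<close>
  then have t1: "t1_space (Ck' X Y y0)"
    using t1_space_expansive[OF top open_Ck'] by blast
  show ?thesis
  proof
    assume analytic: "analytic (Ck' X Y y0)"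
    then have "cosmic (Ck' X Y y0)"
      using regular t1 analytic_imp_countable_network unfolding cosmic_def by blast
    moreover have "analytic (Cp' X Y y0)"
      using analytic_continuous_map_image[OF analytic id] top by simp
    ultimately show "cosmic (Ck' X Y y0) \<and> analytic (Cp' X Y y0)" ..
  next
    assume "cosmic (Ck' X Y y0) \<and> analytic (Cp' X Y y0)"
    then show "analytic (Ck' X Y y0)"
      using analytic_finer_topology[OF _ top base] unfolding cosmic_def by blast
  qed
qed

end
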